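(* Let $r\ge2$, $\ell\ge2$. In the ring $\widetilde{\mathcal{T}}_\ell(C_r)$ the following hold for all $u\in\frac12\mathbb{Z}$: (1) $T^{(a)}_m(u+r+1+\ell)=T^{(a)}_{2\ell-m}(u)$ for $1\le a\le r-1$, $1\le m\le 2\ell-1$, and $T^{(r)}_m(u+r+1+\ell)=T^{(r)}_\ell(u)\,T^{(r)}_{\ell-m}(u)$ for $1\le m\le\ell-1$; (2) $T^{(a)}_m(u+2(r+1+\ell))=T^{(a)}_m(u)$ for all generators $T^{(a)}_m(u)$.
   Context: $\widetilde{\mathcal{T}}_\ell(C_r)$ (level $\ell$ restricted T-system of type $C_r$ with quasi-unit boundary condition) is the commutative ring with generators $T^{(a)}_m(u)^{\pm1}$ ($1\le a\le r-1$, $1\le m\le 2\ell-1$; and $a=r$, $1\le m\le\ell-1$; $u\in\frac12\mathbb{Z}$) and $T^{(r)}_\ell(u)$ ($u\in\frac12\mathbb{Z}$), with relations, for all $u\in\frac12\mathbb{Z}$: $T^{(a)}_m(u-\frac12)T^{(a)}_m(u+\frac12)=T^{(a)}_{m-1}(u)T^{(a)}_{m+1}(u)+T^{(a-1)}_m(u)T^{(a+1)}_m(u)$ ($1\le a\le r-2$, $1\le m\le2\ell-1$); $T^{(r-1)}_{2m}(u-\frac12)T^{(r-1)}_{2m}(u+\frac12)=T^{(r-1)}_{2m-1}(u)T^{(r-1)}_{2m+1}(u)+T^{(r-2)}_{2m}(u)T^{(r)}_m(u-\frac12)T^{(r)}_m(u+\frac12)$ ($1\le m\le\ell-1$); $T^{(r-1)}_{2m+1}(u-\frac12)T^{(r-1)}_{2m+1}(u+\frac12)=T^{(r-1)}_{2m}(u)T^{(r-1)}_{2m+2}(u)+T^{(r-2)}_{2m+1}(u)T^{(r)}_m(u)T^{(r)}_{m+1}(u)$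 ($0\le m\le\ell-1$); $T^{(r)}_m(u-1)T^{(r)}_m(u+1)=T^{(r)}_{m-1}(u)T^{(r)}_{m+1}(u)+T^{(r-1)}_{2m}(u)$ ($1\le m\le\ell-1$); with $T^{(0)}_m(u)=T^{(a)}_0(u)=1$ and $T^{(a)}_{2\ell}(u)=1$ ($1\le a\le r-1$) on the right sides, and $T^{(r)}_\ell(u)^2=1$, $T^{(r)}_\ell(u+1)=T^{(r)}_\ell(u)$. *)

theory Defs
  imports Main
begin

text \<open>Level l restricted T-system of type C_r with quasi-unit boundary condition.
  The spectral parameter u in (1/2)Z is encoded by the integer v = 2u, so
  u +- 1/2 becomes v +- 1 and u +- 1 becomes v +- 2.
  A family T a m v in a commutative ring is a model of the presented ring
  tilde T_l(C_r) iff the predicate below holds (generators with inverses are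
  units; boundary values are 1; the relations hold).\<close>

definition is_TsysC :: "nat \<Rightarrow> nat \<Rightarrow> (nat \<Rightarrow> nat \<Rightarrow> int \<Rightarrow> 'a::comm_ring_1) \<Rightarrow> bool" where
  "is_TsysC r l T \<longleftrightarrow>
    \<comment> \<open>invertible generators\<close>
    (\<forall>a m v. 1 \<le> a \<and> a \<le> r - 1 \<and> 1 \<le> m \<and> m \<le> 2*l - 1 \<longrightarrow> T a m v dvd 1) \<and>
    (\<forall>m v. 1 \<le> m \<and> m \<le> l - 1 \<longrightarrow> T r m v dvd 1) \<and>
    \<comment> \<open>boundary values\<close>
    (\<forall>m v. T 0 m v = 1) \<and>
    (\<forall>a v. 1 \<le> a \<and> a \<le> r \<longrightarrow> T a 0 v = 1) \<and>
    (\<forall>a v. 1 \<le> a \<and> a \<le> r - 1 \<longrightarrow> T a (2*l) v = 1) \<and>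
    \<comment> \<open>T-system relations\<close>
    (\<forall>a m v. 1 \<le> a \<and> a \<le> r - 2 \<and> 1 \<le> m \<and> m \<le> 2*l - 1 \<longrightarrow>
       T a m (v - 1) * T a m (v + 1) =
       T a (m - 1) v * T a (m + 1) v + T (a - 1) m v * T (a + 1) m v) \<and>
    (\<forall>m v. 1 \<le> m \<and> m \<le> l - 1 \<longrightarrow>
       T (r - 1) (2*m) (v - 1) * T (r - 1) (2*m) (v + 1) =
       T (r - 1) (2*m - 1) v * T (r - 1) (2*m + 1) v
       + T (r - 2) (2*m) v * T r m (v - 1) * T r m (v + 1)) \<and>
    (\<forall>m v. m \<le> l - 1 \<longrightarrow>
       T (r - 1) (2*m + 1) (v - 1) * T (r - 1) (2*m + 1) (v + 1) =
       T (r - 1) (2*m) v * T (r - 1) (2*m + 2) v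
       + T (r - 2) (2*m + 1) v * T r m v * T r (m + 1) v) \<and>
    (\<forall>m v. 1 \<le> m \<and> m \<le> l - 1 \<longrightarrow>
       T r m (v - 2) * T r m (v + 2) =
       T r (m - 1) v * T r (m + 1) v + T (r - 1) (2*m) v) \<and>
    (\<forall>v. T r l v ^ 2 = 1) \<and>
    (\<forall>v. T r l (v + 2) = T r l v)"

end

theory Submission
  imports Defs "Jordan_Normal_Form.Char_Poly"
begin

text \<open>
  Put \<open>R = r + 1\<close> and \<open>L = 2 l\<close>. Replacing the row \<open>T r\<close> by the products
  \<open>T r m (v - 1) * T r m (v + 1)\<close> (for index \<open>2 m\<close>) and \<open>T r m v * T r (m + 1) v\<close> (for
  \<open>2 m + 1\<close>) and adding a row \<open>R\<close> with entries \<open>(T r m v)\<^sup>2\<close> and \<open>0\<close> turns the system into the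
  lower half of a type \<open>A\<close> T-system (Hirota equation) \<open>S\<close> of height \<open>2 R\<close>, symmetric up to
  the sign \<open>(-1)^m\<close> under \<open>a \<mapsto> 2 R - a\<close>. By Desnanot-Jacobi, \<open>S\<close> consists of the
  solid minors of the banded matrix \<open>P\<close> whose diagonals are the first column \<open>S a 1\<close> and its
  negated mirror image; row \<open>R\<close> is given by alternating determinants, which handles its zeros.

  The boundary condition at \<open>m = L\<close> says that solid minors of size \<open>L\<close> are \<open>1\<close> and those of
  size \<open>L + 1\<close> vanish, so \<open>L + 1\<close> consecutive rows of \<open>P\<close> satisfy one linear relation on all
  of their columns but the two extreme ones. Solving for its coefficients by Cramer's rule from the
  left and from the right end gives \<open>S 1 k v\<close> and \<open>S 1 (L - k) (v + 2 R + L)\<close>, which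
  is the half periodicity for \<open>a = 1\<close>; the Hirota equation propagates it to \<open>a \<le> r\<close>, and
  the row \<open>T r\<close> is recovered from its products.
\<close>

section \<open>Determinants of matrices given by entry functions\<close>

text \<open>Entries are a function on all index pairs, so that minors arise by composing indices,
  without carriers.\<close>

definition fdet :: "nat \<Rightarrow> (nat \<Rightarrow> nat \<Rightarrow> 'a) \<Rightarrow> 'a::comm_ring_1" where
  "fdet n f = det (mat n n (\<lambda>(i, j). f i j))"

text \<open>\<open>insert_index i\<close> skips the index \<open>i\<close>, so \<open>fcof n\<close>
  belongs to matrices of size \<open>Suc n\<close>.\<close>

definition fcof :: "nat \<Rightarrow> (nat \<Rightarrow> nat \<Rightarrow> 'a) \<Rightarrow> nat \<Rightarrow> nat \<Rightarrow> 'a::comm_ring_1" where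
  "fcof n f i j = (- 1) ^ (i + j) * fdet n (\<lambda>p q. f (insert_index i p) (insert_index j q))"

lemma fdet_cong:
  assumes "\<And>i j. i < n \<Longrightarrow> j < n \<Longrightarrow> f i j = g i j"
  shows "fdet n f = fdet n g"
  unfolding fdet_def by (rule arg_cong[where f = det]) (auto intro!: eq_matI simp: assms)

lemma fcof_eq_cofactor:
  assumes "i < Suc n" "j < Suc n"
  shows "cofactor (mat (Suc n) (Suc n) (\<lambda>(i, j). f i j)) i j = fcof n f i j"
proof -
  have "mat_delete (mat (Suc n) (Suc n) (\<lambda>(i, j). f i j)) i j
      = mat n n (\<lambda>(p, q). f (insert_index i p) (insert_index j q))"
    using assms by (intro eq_matI) (auto simp: mat_delete_def insert_index_def)
  then show ?thesis by (simp add: cofactor_def fcof_def fdet_def)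
qed

lemma fdet_0 [simp]: "fdet 0 f = 1"
  by (simp add: fdet_def)

lemma fdet_Suc_0 [simp]: "fdet (Suc 0) f = f 0 0"
  by (simp add: fdet_def det_single)

lemma fdet_transpose: "fdet n (\<lambda>i j. f j i) = fdet n f"
proof -
  have "mat n n (\<lambda>(i, j). f j i) = transpose_mat (mat n n (\<lambda>(i, j). f i j))"
    by (intro eq_matI) auto
  then show ?thesis unfolding fdet_def by (simp add: det_transpose[of _ n])
qed

lemma fdet_uminus: "fdet n (\<lambda>i j. - f i j) = (- 1) ^ n * fdet n f"
proof -
  have "mat n n (\<lambda>(i, j). - f i j) = (- 1) \<cdot>\<^sub>m mat n n (\<lambda>(i, j). f i j)"
    by (intro eq_matI) auto
  then show ?thesis unfolding fdet_def by simp
qed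

lemma fdet_mult:
  "fdet n (\<lambda>i j. \<Sum>k<n. f i k * g k j) = fdet n f * fdet n g"
proof -
  have "mat n n (\<lambda>(i, j). \<Sum>k<n. f i k * g k j)
      = mat n n (\<lambda>(i, j). f i j) * mat n n (\<lambda>(i, j). g i j)"
    by (intro eq_matI) (auto simp: scalar_prod_def lessThan_atLeast0)
  then show ?thesis unfolding fdet_def by (simp add: det_mult[of _ n])
qed

lemma fdet_expand_row:
  assumes "i < Suc n"
  shows "fdet (Suc n) f = (\<Sum>j<Suc n. f i j * fcof n f i j)"
  unfolding fdet_def using assms
  by (subst laplace_expansion_row[of _ "Suc n" i]) (auto intro!: sum.cong simp: fcof_eq_cofactor)

lemma fdet_expand_col:
  assumes "j < Suc n"
  shows "fdet (Suc n) f = (\<Sum>i<Suc n. f i j * fcof n f i j)"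
  unfolding fdet_def using assms
  by (subst laplace_expansion_column[of _ "Suc n" j]) (auto intro!: sum.cong simp: fcof_eq_cofactor)

lemma sum_fcof_row:
  assumes "i < Suc n" "j < Suc n"
  shows "(\<Sum>k<Suc n. f i k * fcof n f j k) = (if i = j then fdet (Suc n) f else 0)"
proof -
  let ?A = "mat (Suc n) (Suc n) (\<lambda>(i, j). f i j)"
  have "(?A * adj_mat ?A) $$ (i, j) = (det ?A \<cdot>\<^sub>m 1\<^sub>m (Suc n)) $$ (i, j)"
    by (simp add: adj_mat(2)[of _ "Suc n"])
  then show ?thesis using assms
    by (simp add: adj_mat_def scalar_prod_def fcof_eq_cofactor fdet_def lessThan_atLeast0
        del: sum.op_ivl_Suc split: if_splits)
qed

lemma sum_fcof_col:
  assumes "i < Suc n" "j < Suc n"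
  shows "(\<Sum>k<Suc n. fcof n f k i * f k j) = (if i = j then fdet (Suc n) f else 0)"
proof -
  let ?A = "mat (Suc n) (Suc n) (\<lambda>(i, j). f i j)"
  have "(adj_mat ?A * ?A) $$ (i, j) = (det ?A \<cdot>\<^sub>m 1\<^sub>m (Suc n)) $$ (i, j)"
    by (simp add: adj_mat(3)[of _ "Suc n"])
  then show ?thesis using assms
    by (simp add: adj_mat_def scalar_prod_def fcof_eq_cofactor fdet_def lessThan_atLeast0
        del: sum.op_ivl_Suc split: if_splits)
qed

lemma fdet_first_col:
  assumes "\<And>i. 0 < i \<Longrightarrow> i \<le> n \<Longrightarrow> f i 0 = 0"
  shows "fdet (Suc n) f = f 0 0 * fdet n (\<lambda>i j. f (Suc i) (Suc j))"
proof -
  have "fdet (Suc n) f = (\<Sum>i<Suc n. f i 0 * fcof n f i 0)"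
    by (rule fdet_expand_col) simp
  also have "\<dots> = (\<Sum>i<Suc n. if i = 0 then f 0 0 * fcof n f 0 0 else 0)"
    by (intro sum.cong) (auto simp: assms)
  finally show ?thesis by (simp add: fcof_def insert_index_def del: sum.lessThan_Suc)
qed

lemma fdet_last_col:
  assumes "\<And>i. i < n \<Longrightarrow> f i n = 0"
  shows "fdet (Suc n) f = f n n * fdet n f"
proof -
  have "fdet (Suc n) f = (\<Sum>i<Suc n. f i n * fcof n f i n)"
    by (rule fdet_expand_col) simp
  also have "\<dots> = (\<Sum>i<Suc n. if i = n then f n n * fcof n f n n else 0)"
    by (intro sum.cong) (auto simp: assms)
  also have "\<dots> = f n n * fcof n f n n" by (simp del: sum.lessThan_Suc)
  also have "fcof n f n n = fdet n f"
    by (auto simp: fcof_def insert_index_def intro!: fdet_cong)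
  finally show ?thesis .
qed

lemma fdet_upper_unitriangular:
  assumes "\<And>i j. j < i \<Longrightarrow> i < n \<Longrightarrow> f i j = 0" "\<And>i. i < n \<Longrightarrow> f i i = c"
  shows "fdet n f = c ^ n"
  using assms
proof (induction n)
  case (Suc n)
  have "fdet (Suc n) f = fdet (Suc n) (\<lambda>i j. f j i)"
    by (rule fdet_transpose[symmetric])
  also have "\<dots> = f n n * fdet n (\<lambda>i j. f j i)"
    using Suc.prems(1) by (intro fdet_last_col) auto
  also have "fdet n (\<lambda>i j. f j i) = fdet n f"
    by (rule fdet_transpose)
  also have "fdet n f = c ^ n"
    using Suc by simp
  finally show ?case
    using Suc.prems(2) by simp
qed simp

section \<open>The Desnanot-Jacobi identity over commutative rings\<close>

lemma fcof_first_first: "fcof n f 0 0 = fdet n (\<lambda>i j. f (Suc i) (Suc j))"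
  by (simp add: fcof_def insert_index_def)

lemma fcof_last_last: "fcof n f n n = fdet n f"
  by (auto simp: fcof_def insert_index_def intro!: fdet_cong)

lemma fcof_first_last: "fcof n f 0 n = (- 1) ^ n * fdet n (\<lambda>i j. f (Suc i) j)"
  by (auto simp: fcof_def insert_index_def intro!: fdet_cong arg_cong2[where f = "(*)"])

lemma fcof_last_first: "fcof n f n 0 = (- 1) ^ n * fdet n (\<lambda>i j. f i (Suc j))"
  by (auto simp: fcof_def insert_index_def intro!: fdet_cong arg_cong2[where f = "(*)"])

text \<open>The inner columns are those of the identity matrix, so only the 2 by 2 minor of the four
  corners survives.\<close>

lemma fdet_bordered_identity:
  fixes a b :: "nat \<Rightarrow> 'a::comm_ring_1"
  shows "fdet (Suc (Suc n)) (\<lambda>i j. if j = 0 then a i else if j = Suc n then b i else of_bool (i = j))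
    = a 0 * b (Suc n) - a (Suc n) * b 0"
proof -
  let ?f = "\<lambda>i j. if j = 0 then a i else if j = Suc n then b i else of_bool (i = j)"
  have "fdet (Suc (Suc n)) ?f = (\<Sum>j<Suc (Suc n). ?f (Suc n) j * fcof (Suc n) ?f (Suc n) j)"
    by (rule fdet_expand_row) simp
  also have "\<dots> = (\<Sum>j<Suc (Suc n). (if j = 0 then a (Suc n) * fcof (Suc n) ?f (Suc n) 0 else 0)
      + (if j = Suc n then b (Suc n) * fcof (Suc n) ?f (Suc n) (Suc n) else 0))"
    by (intro sum.cong) auto
  also have "\<dots> = a (Suc n) * fcof (Suc n) ?f (Suc n) 0 + b (Suc n) * fcof (Suc n) ?f (Suc n) (Suc n)"
    by (simp add: sum.distrib del: sum.lessThan_Suc)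
  also have "fcof (Suc n) ?f (Suc n) (Suc n) = a 0"
  proof -
    have "fdet (Suc n) ?f = fdet (Suc n) (\<lambda>i j. ?f j i)"
      by (rule fdet_transpose[symmetric])
    also have "\<dots> = a 0 * fdet n (\<lambda>i j. ?f (Suc j) (Suc i))"
      by (subst fdet_first_col) auto
    also have "fdet n (\<lambda>i j. ?f (Suc j) (Suc i)) = 1 ^ n"
      by (rule fdet_upper_unitriangular) auto
    finally show ?thesis by (simp add: fcof_last_last)
  qed
  also have "fcof (Suc n) ?f (Suc n) 0 = - b 0"
  proof -
    have "fdet (Suc n) (\<lambda>i j. ?f i (Suc j)) = (\<Sum>j<Suc n. ?f 0 (Suc j) * fcof n (\<lambda>i j. ?f i (Suc j)) 0 j)"
      by (rule fdet_expand_row) simp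
    also have "\<dots> = (\<Sum>j<Suc n. if j = n then b 0 * fcof n (\<lambda>i j. ?f i (Suc j)) 0 n else 0)"
      by (intro sum.cong) auto
    also have "\<dots> = b 0 * fcof n (\<lambda>i j. ?f i (Suc j)) 0 n"
      by (simp del: sum.lessThan_Suc)
    also have "fcof n (\<lambda>i j. ?f i (Suc j)) 0 n = (- 1) ^ n * fdet n (\<lambda>i j. ?f (Suc i) (Suc j))"
      by (rule fcof_first_last)
    also have "fdet n (\<lambda>i j. ?f (Suc i) (Suc j)) = 1 ^ n"
      by (rule fdet_upper_unitriangular) auto
    finally have "fdet (Suc n) (\<lambda>i j. ?f i (Suc j)) = b 0 * (- 1) ^ n" by simp
    then have "fcof (Suc n) ?f (Suc n) 0 = - (b 0 * ((- 1) ^ n * (- 1) ^ n))"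
      unfolding fcof_last_first by (simp add: ac_simps)
    then show ?thesis by (simp flip: power_mult_distrib)
  qed
  finally show ?thesis by (simp add: algebra_simps)
qed

text \<open>Multiply \<open>f\<close> by the identity matrix whose outer columns are replaced by the
  cofactors of the first and last rows of \<open>f\<close>, and compare determinants. The common
  factor \<open>d\<close> stays, since it may be a zero divisor.\<close>

lemma fdet_mult_Desnanot_Jacobi:
  fixes f :: "nat \<Rightarrow> nat \<Rightarrow> 'a::comm_ring_1"
  assumes d_def: "d = fdet (Suc (Suc n)) f"
  shows "d * (d * fdet n (\<lambda>i j. f (Suc i) (Suc j)))
    = d * (fdet (Suc n) f * fdet (Suc n) (\<lambda>i j. f (Suc i) (Suc j))
      - fdet (Suc n) (\<lambda>i j. f i (Suc j)) * fdet (Suc n) (\<lambda>i j. f (Suc i) j))"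
proof -
  let ?C = "fcof (Suc n) f"
  let ?g = "\<lambda>i j. if j = 0 then ?C 0 i else if j = Suc n then ?C (Suc n) i else of_bool (i = j)"
  let ?h = "\<lambda>i j. if j = 0 then (if i = 0 then d else 0)
      else if j = Suc n then (if i = Suc n then d else 0) else f i j"
  \<comment> \<open>By the adjugate identity the outer columns of the product are \<open>d\<close>
    times unit vectors.\<close>
  have "fdet (Suc (Suc n)) (\<lambda>i j. \<Sum>k<Suc (Suc n). f i k * ?g k j) = fdet (Suc (Suc n)) ?h"
  proof (rule fdet_cong)
    fix i j assume ij: "i < Suc (Suc n)" "j < Suc (Suc n)"
    consider "j = 0" | "j = Suc n" | "j \<noteq> 0" "j \<noteq> Suc n" by blast
    then show "(\<Sum>k<Suc (Suc n). f i k * ?g k j) = ?h i j"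
    proof cases
      case 3
      have "(\<Sum>k<Suc (Suc n). f i k * ?g k j) = (\<Sum>k<Suc (Suc n). if k = j then f i j else 0)"
        using 3 by (intro sum.cong) auto
      then show ?thesis using 3 ij by (simp del: sum.lessThan_Suc)
    qed (use ij sum_fcof_row[of i "Suc n" _ f] in \<open>simp_all del: sum.lessThan_Suc add: d_def\<close>)
  qed
  also have "\<dots> = d * fdet (Suc n) (\<lambda>i j. ?h (Suc i) (Suc j))"
    by (subst fdet_first_col) auto
  also have "fdet (Suc n) (\<lambda>i j. ?h (Suc i) (Suc j)) = d * fdet n (\<lambda>i j. ?h (Suc i) (Suc j))"
    by (subst fdet_last_col) auto
  also have "fdet n (\<lambda>i j. ?h (Suc i) (Suc j)) = fdet n (\<lambda>i j. f (Suc i) (Suc j))"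
    by (rule fdet_cong) auto
  finally have "d * fdet (Suc (Suc n)) ?g = d * (d * fdet n (\<lambda>i j. f (Suc i) (Suc j)))"
    unfolding fdet_mult d_def by simp
  also have "fdet (Suc (Suc n)) ?g = ?C 0 0 * ?C (Suc n) (Suc n) - ?C 0 (Suc n) * ?C (Suc n) 0"
    by (rule fdet_bordered_identity)
  finally have "d * (d * fdet n (\<lambda>i j. f (Suc i) (Suc j)))
      = d * (?C 0 0 * ?C (Suc n) (Suc n) - ?C 0 (Suc n) * ?C (Suc n) 0)" ..
  also have "?C 0 (Suc n) * ?C (Suc n) 0
      = ((- 1) ^ (Suc n) * (- 1) ^ (Suc n)) * (fdet (Suc n) (\<lambda>i j. f i (Suc j)) * fdet (Suc n) (\<lambda>i j. f (Suc i) j))"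
    unfolding fcof_first_last fcof_last_first by (simp add: ac_simps)
  also have "(- 1) ^ (Suc n) * (- 1) ^ (Suc n) = (1::'a)"
    by (simp flip: power_mult_distrib)
  finally show ?thesis by (simp add: fcof_first_first fcof_last_last ac_simps)
qed

text \<open>The leading coefficient of \<open>q\<close> reappears in the product, even if the ring
  has zero divisors.\<close>

lemma monic_mult_cancel:
  fixes p q :: "'a::comm_ring_1 poly"
  assumes "lead_coeff p = 1" "p * q = 0"
  shows "q = 0"
proof -
  have "lead_coeff p * lead_coeff q = coeff (p * q) (degree p + degree q)"
    by (simp add: coeff_mult_degree_sum)
  then show ?thesis using assms by simp
qed

text \<open>Replacing the matrix by its characteristic matrix makes the determinant regular, so that it
  can be cancelled over every commutative ring.\<close>

lemma Desnanot_Jacobi: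
  fixes f :: "nat \<Rightarrow> nat \<Rightarrow> 'a::comm_ring_1"
  shows "fdet (Suc (Suc n)) f * fdet n (\<lambda>i j. f (Suc i) (Suc j))
    = fdet (Suc n) f * fdet (Suc n) (\<lambda>i j. f (Suc i) (Suc j))
      - fdet (Suc n) (\<lambda>i j. f i (Suc j)) * fdet (Suc n) (\<lambda>i j. f (Suc i) j)"
proof -
  define g where "g = (\<lambda>i j. [: f i j, of_bool (i = j) :])"
  \<comment> \<open>Evaluation at 0 returns to \<open>f\<close>; the index maps \<open>s\<close> and
    \<open>t\<close> cover all minors at once.\<close>
  have ev: "poly (fdet m (\<lambda>i j. g (s i) (t j))) 0 = fdet m (\<lambda>i j. f (s i) (t j))" for m s t
  proof -
    have "comm_ring_hom (\<lambda>p::'a poly. poly p 0)" by standard auto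
    note hom_det = comm_ring_hom.hom_det[OF this]
    have "map_mat (\<lambda>p. poly p 0) (mat m m (\<lambda>(i, j). g (s i) (t j))) = mat m m (\<lambda>(i, j). f (s i) (t j))"
      by (intro eq_matI) (auto simp: g_def)
    then show ?thesis unfolding fdet_def by (metis hom_det)
  qed
  \<comment> \<open>\<open>char_poly\<close> is the determinant of x I - A, hence the sign.\<close>
  let ?A = "mat (Suc (Suc n)) (Suc (Suc n)) (\<lambda>(i, j). - f i j)"
  have "fdet (Suc (Suc n)) g = char_poly ?A"
    unfolding fdet_def char_poly_defs
    by (intro arg_cong[where f = det] eq_matI) (auto simp: g_def)
  then have "lead_coeff (fdet (Suc (Suc n)) g) = 1"
    using degree_monic_char_poly[of ?A "Suc (Suc n)"] by simp
  from monic_mult_cancel[OF this, of "fdet (Suc (Suc n)) g * fdet n (\<lambda>i j. g (Suc i) (Suc j))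
    - (fdet (Suc n) g * fdet (Suc n) (\<lambda>i j. g (Suc i) (Suc j))
      - fdet (Suc n) (\<lambda>i j. g i (Suc j)) * fdet (Suc n) (\<lambda>i j. g (Suc i) j))"]
  have "fdet (Suc (Suc n)) g * fdet n (\<lambda>i j. g (Suc i) (Suc j))
    = fdet (Suc n) g * fdet (Suc n) (\<lambda>i j. g (Suc i) (Suc j))
      - fdet (Suc n) (\<lambda>i j. g i (Suc j)) * fdet (Suc n) (\<lambda>i j. g (Suc i) j)"
    using fdet_mult_Desnanot_Jacobi[OF refl, of n g] by (simp add: right_diff_distrib)
  from arg_cong[OF this, of "\<lambda>p. poly p 0"] show ?thesis
    using ev[of _ "\<lambda>i. i" "\<lambda>i. i"] ev[of _ Suc Suc] ev[of _ "\<lambda>i. i" Suc] ev[of _ Suc "\<lambda>i. i"]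
    by simp
qed


section \<open>Cramer's rule and alternating determinants\<close>

text \<open>Cramer's rule: \<open>c\<close> times the matrix vanishes outside column
  \<open>s\<close>, and multiplying by the adjugate isolates \<open>c k\<close>.\<close>

lemma sum_rows_cofactor:
  fixes f :: "nat \<Rightarrow> nat \<Rightarrow> 'a::comm_ring_1"
  assumes "k < Suc n" "s < Suc n"
    and "\<And>q. q < Suc n \<Longrightarrow> q \<noteq> s \<Longrightarrow> (\<Sum>p<Suc n. c p * f p q) = 0"
  shows "c k * fdet (Suc n) f = (\<Sum>p<Suc n. c p * f p s) * fcof n f k s"
proof -
  have "(\<Sum>p<Suc n. c p * f p s) * fcof n f k s
      = (\<Sum>q<Suc n. if q = s then (\<Sum>p<Suc n. c p * f p s) * fcof n f k s else 0)"
    using assms(2) by (simp del: sum.lessThan_Suc)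
  also have "\<dots> = (\<Sum>q<Suc n. (\<Sum>p<Suc n. c p * f p q) * fcof n f k q)"
    by (intro sum.cong) (auto simp: assms(3) simp del: sum.lessThan_Suc)
  also have "\<dots> = (\<Sum>q<Suc n. \<Sum>p<Suc n. c p * (f p q * fcof n f k q))"
    by (simp add: sum_distrib_right mult.assoc del: sum.lessThan_Suc)
  also have "\<dots> = (\<Sum>p<Suc n. c p * (\<Sum>q<Suc n. f p q * fcof n f k q))"
    by (subst sum.swap) (simp add: sum_distrib_left del: sum.lessThan_Suc)
  also have "\<dots> = (\<Sum>p<Suc n. if p = k then c k * fdet (Suc n) f else 0)"
    using assms(1) by (intro sum.cong) (auto simp: sum_fcof_row simp del: sum.lessThan_Suc)
  finally show ?thesis using assms(1) by (simp del: sum.lessThan_Suc)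
qed

text \<open>Fixed points need their own hypothesis: with 2-torsion, \<open>f x = - f x\<close> does
  not give \<open>f x = 0\<close>.\<close>

lemma sum_involution_cancel:
  fixes f :: "'b \<Rightarrow> 'a::ab_group_add"
  assumes "finite A"
    and "\<And>x. x \<in> A \<Longrightarrow> t x \<in> A" "\<And>x. x \<in> A \<Longrightarrow> t (t x) = x"
    and "\<And>x. x \<in> A \<Longrightarrow> f (t x) = - f x" "\<And>x. x \<in> A \<Longrightarrow> t x = x \<Longrightarrow> f x = 0"
  shows "sum f A = 0"
  using assms
proof (induction "card A" arbitrary: A rule: less_induct)
  case less
  show ?case
  proof (cases "A = {}")
    case False
    then obtain x where x: "x \<in> A" by blast
    let ?B = "A - {x, t x}"
    have "card ?B < card A"
      using x less.prems(1) by (intro psubset_card_mono) auto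
    moreover have "t y \<in> ?B" if "y \<in> ?B" for y
      using that x less.prems(2,3) by (metis DiffD1 DiffD2 DiffI insertCI insertE singletonD)
    ultimately have "sum f ?B = 0"
      using less.prems by (intro less.hyps) auto
    moreover have "sum f A = sum f ?B + sum f {x, t x}"
      using x less.prems(1,2) by (intro sum.subset_diff) auto
    moreover have "sum f {x, t x} = 0"
      using x less.prems(4,5) by (cases "t x = x") auto
    ultimately show ?thesis by simp
  qed simp
qed

text \<open>Without a fixed point \<open>p\<close> matches the indices it lowers with those it
  raises, so \<open>n\<close> would be even.\<close>

lemma involution_odd_fixpoint:
  fixes p :: "nat \<Rightarrow> nat"
  assumes "odd n" "\<And>i. i < n \<Longrightarrow> p i < n" "\<And>i. i < n \<Longrightarrow> p (p i) = i"
  shows "\<exists>i<n. p i = i"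
proof (rule ccontr)
  assume neg: "\<not> ?thesis"
  let ?A = "{i. i < n \<and> p i < i}" and ?B = "{i. i < n \<and> i < p i}"
  have "bij_betw p ?A ?B"
    by (rule bij_betwI[where g = p]) (use assms in auto)
  then have "card ?A = card ?B" by (rule bij_betw_same_card)
  moreover have "card (?A \<union> ?B) = card ?A + card ?B"
    by (intro card_Un_disjoint) auto
  moreover have "?A \<union> ?B = {..<n}"
    using neg by auto
  ultimately have "n = card ?B + card ?B" by simp
  then show False using \<open>odd n\<close> by (metis even_add)
qed

text \<open>In rings with 2-torsion \<open>det A = - det A\<close> is not enough; the Leibniz sum cancels in pairs
  \<open>p, p\<inverse>\<close>, and an involution of an odd set hits the zero diagonal.\<close>

lemma fdet_alternating_odd:
  fixes f :: "nat \<Rightarrow> nat \<Rightarrow> 'a::comm_ring_1"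
  assumes "odd n" "\<And>i. i < n \<Longrightarrow> f i i = 0"
    and skew: "\<And>i j. i < n \<Longrightarrow> j < n \<Longrightarrow> f j i = - f i j"
  shows "fdet n f = 0"
proof -
  let ?inv = "Hilbert_Choice.inv :: (nat \<Rightarrow> nat) \<Rightarrow> nat \<Rightarrow> nat"
  let ?t = "\<lambda>p. signof p * (\<Prod>i = 0..<n. f i (p i)) :: 'a"
  have "fdet n f = (\<Sum>p\<in>{p. p permutes {0..<n}}. ?t p)"
    unfolding fdet_def
  proof (subst det_def'[of _ n], simp, intro sum.cong refl arg_cong2[where f = "(*)"] prod.cong)
    fix p i assume "p \<in> {p. p permutes {0..<n}}" "i \<in> {0..<n}"
    then show "mat n n (\<lambda>(i, j). f i j) $$ (i, p i) = f i (p i)"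
      using permutes_in_image[of p "{0..<n}" i] by simp
  qed
  also have "\<dots> = 0"
  proof (rule sum_involution_cancel[where t = ?inv])
    show "finite {p. p permutes {0..<n}}" by (simp add: finite_permutations)
  next
    fix p :: "nat \<Rightarrow> nat" assume "p \<in> {p. p permutes {0..<n}}"
    then have p: "p permutes {0..<n}" by simp
    then show "?inv p \<in> {p. p permutes {0..<n}}" by (simp add: permutes_inv)
    from p show "?inv (?inv p) = p" by (rule permutes_inv_inv)
    have lt: "p i < n" if "i < n" for i
      using permutes_in_image[OF p, of i] that by simp
    have "(\<Prod>i = 0..<n. f i (?inv p i)) = (\<Prod>i = 0..<n. f (p i) i)"
      by (subst prod.permute[OF p]) (simp add: permutes_inverses[OF p] comp_def)
    also have "\<dots> = (\<Prod>i = 0..<n. (- 1) * f i (p i))"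
    proof (intro prod.cong refl)
      fix i assume "i \<in> {0..<n}"
      then show "f (p i) i = (- 1) * f i (p i)" using skew[of i "p i"] lt[of i] by simp
    qed
    also have "\<dots> = (- 1) ^ n * (\<Prod>i = 0..<n. f i (p i))"
      by (subst prod.distrib) simp
    finally show "?t (?inv p) = - ?t p"
      using \<open>odd n\<close> sign_inverse[OF permutes_imp_permutation[OF _ p]] by simp

    assume "?inv p = p"
    then have "p (p i) = i" for i using permutes_inverses(1)[OF p, of i] by simp
    then obtain i where "i < n" "p i = i"
      using involution_odd_fixpoint[of n p] \<open>odd n\<close> lt by blast
    then have "(\<Prod>i = 0..<n. f i (p i)) = 0"
      using assms(2)[of i] by (intro prod_zero) (auto intro!: bexI[of _ i])
    then show "?t p = 0" by simp
  qed
  finally show ?thesis .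
qed

lemma unit_cancel:
  fixes x y z :: "'a::comm_ring_1"
  assumes "x dvd 1" "x * y = x * z"
  shows "y = z"
proof -
  from assms(1) obtain u where "1 = x * u" by (rule dvdE)
  then have "y = u * (x * y)" "z = u * (x * z)"
    by (metis mult.commute mult.left_commute mult_1)+
  then show ?thesis using assms(2) by simp
qed

lemma sum_lessThan_add:
  fixes g :: "nat \<Rightarrow> 'a::comm_monoid_add"
  shows "(\<Sum>p<k + m. g p) = (\<Sum>p<k. g p) + (\<Sum>p<m. g (k + p))"
  by (induction m) (simp_all add: add.assoc)

section \<open>Half periodicity of skew friezes\<close>

text \<open>\<open>S_middle_even\<close> is the Hirota equation on the mirror row \<open>R\<close>
  at the odd index \<open>m + 1\<close>: its left side is 0 and row \<open>R + 1\<close> is minus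
  row \<open>R - 1\<close>.\<close>

locale skew_frieze =
  fixes R L :: nat and S :: "nat \<Rightarrow> nat \<Rightarrow> int \<Rightarrow> 'a::comm_ring_1"
  assumes R: "2 \<le> R" and L: "2 \<le> L" "even L"
    and S_unit: "\<And>a m v. 1 \<le> a \<Longrightarrow> a < R \<Longrightarrow> m \<le> L \<Longrightarrow> S a m v dvd 1"
    and S_bottom: "\<And>m v. S 0 m v = 1"
    and S_left: "\<And>a v. a \<le> R \<Longrightarrow> S a 0 v = 1"
    and S_right: "\<And>a v. a \<le> R \<Longrightarrow> S a L v = 1"
    and Hirota: "\<And>a m v. 1 \<le> a \<Longrightarrow> a < R \<Longrightarrow> 1 \<le> m \<Longrightarrow> m < L \<Longrightarrow>
      S a m (v - 1) * S a m (v + 1) = S a (m - 1) v * S a (m + 1) v + S (a - 1) m v * S (a + 1) m v"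
    and S_middle_unit: "\<And>m v. even m \<Longrightarrow> m \<le> L \<Longrightarrow> S R m v dvd 1"
    and S_middle_odd: "\<And>m v. odd m \<Longrightarrow> S R m v = 0"
    and S_middle_even: "\<And>m v. even m \<Longrightarrow> m + 2 \<le> L \<Longrightarrow>
      S R m v * S R (m + 2) v = (S (R - 1) (m + 1) v)\<^sup>2"
begin

text \<open>The two terms of \<open>e\<close> have disjoint supports \<open>0 \<le> k < R\<close> and \<open>R < k \<le> 2 R\<close>.\<close>

definition h :: "int \<Rightarrow> int \<Rightarrow> 'a" where
  "h k v = (if 0 \<le> k \<and> k < int R then S (nat k) 1 v else 0)"

definition e :: "int \<Rightarrow> int \<Rightarrow> 'a" where
  "e k v = h k v - h (2 * int R - k) v"

text \<open>A solid minor with upper left entry on diagonal \<open>a\<close>. Its parameter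
  \<open>w\<close> is that of this entry, whereas \<open>S\<close> uses the centre
  \<open>w + m - 1\<close>.\<close>

definition D :: "int \<Rightarrow> nat \<Rightarrow> int \<Rightarrow> 'a" where
  "D a m w = fdet m (\<lambda>p q. e (a + int q - int p) (w + int p + int q))"

section \<open>Solid minors of the banded matrix\<close>

lemma e_skew: "e (2 * int R - k) v = - e k v"
  by (simp add: e_def)

lemma e_middle: "e (int R) v = 0"
  by (simp add: e_def)

lemma e_neg: "k < 0 \<Longrightarrow> e k v = 0"
  by (simp add: e_def h_def)

lemma e_0: "e 0 v = 1"
  using R by (simp add: e_def h_def S_bottom)

lemma e_gt: "2 * int R < k \<Longrightarrow> e k v = 0"
  by (simp add: e_def h_def)

lemma e_top: "e (2 * int R) v = - 1"
  using e_skew[of 0 v] by (simp add: e_0)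

lemma e_eq_S: "a < R \<Longrightarrow> e (int a) v = S a 1 v"
  by (simp add: e_def h_def)

text \<open>Reflecting the diagonal at \<open>R\<close> transposes the matrix and negates every
  entry.\<close>

lemma D_skew: "D (2 * int R - a) m w = (- 1) ^ m * D a m w"
proof -
  have "D (2 * int R - a) m w = fdet m (\<lambda>p q. - e (a + int p - int q) (w + int q + int p))"
    unfolding D_def by (intro fdet_cong, subst e_skew[symmetric]) (simp add: algebra_simps)
  also have "\<dots> = (- 1) ^ m * fdet m (\<lambda>p q. e (a + int p - int q) (w + int q + int p))"
    by (rule fdet_uminus)
  also have "fdet m (\<lambda>p q. e (a + int p - int q) (w + int q + int p)) = D a m w"
    unfolding D_def by (rule fdet_transpose)
  finally show ?thesis .
qed

lemma D_middle_odd: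
  assumes "odd m"
  shows "D (int R) m w = 0"
  unfolding D_def
proof (rule fdet_alternating_odd[OF assms])
  fix p q
  show "e (int R + int p - int q) (w + int q + int p) = - e (int R + int q - int p) (w + int p + int q)"
    by (subst e_skew[symmetric]) (simp add: algebra_simps)
qed (simp add: e_middle)

lemma D_bottom: "D 0 m w = 1"
  unfolding D_def by (subst fdet_upper_unitriangular[where c = 1]) (auto simp: e_neg e_0)

lemma D_top: "D (2 * int R) m w = (- 1) ^ m"
  using D_skew[of 0 m w] by (simp add: D_bottom)

lemma D_0: "D a 0 w = 1"
  by (simp add: D_def)

text \<open>Deleting an outer row or column only moves the corner entry, which shifts
  \<open>a\<close> and \<open>w\<close>.\<close>

lemma D_Hirota:
  "D a (Suc (Suc m)) w * D a m (w + 2)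
    = D a (Suc m) w * D a (Suc m) (w + 2) - D (a + 1) (Suc m) (w + 1) * D (a - 1) (Suc m) (w + 1)"
proof -
  let ?f = "\<lambda>p q. e (a + int q - int p) (w + int p + int q)"
  have "fdet k (\<lambda>p q. ?f (Suc p) (Suc q)) = D a k (w + 2)"
    "fdet k (\<lambda>p q. ?f p (Suc q)) = D (a + 1) k (w + 1)"
    "fdet k (\<lambda>p q. ?f (Suc p) q) = D (a - 1) k (w + 1)" for k
    unfolding D_def by (auto intro!: fdet_cong simp: algebra_simps)
  then show ?thesis
    using Desnanot_Jacobi[of m ?f] unfolding D_def by simp
qed

text \<open>Both sides obey the same recursion in \<open>m\<close>, which determines size
  \<open>m\<close> after division by the unit \<open>S a (m - 2) v\<close>.\<close>

lemma D_eq_S: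
  assumes "m \<le> L" "a \<le> R"
  shows "D (int a) m (v - int m + 1) = S a m v"
  using assms
proof (induction m arbitrary: a v rule: less_induct)
  case (less m)
  consider "m = 0" | "m = 1" | k where "m = Suc (Suc k)"
    by (metis One_nat_def not0_implies_Suc)
  then show ?case
  proof cases
    case 1
    then show ?thesis using less.prems by (simp add: D_0 S_left)
  next
    case 2
    then have "D (int a) m (v - int m + 1) = e (int a) v"
      by (simp add: D_def)
    then show ?thesis
      using 2 less.prems e_eq_S[of a v] by (cases "a = R") (auto simp: e_middle S_middle_odd)
  next
    case (3 k)
    have IH: "D (int b) (Suc k) (u - int k) = S b (Suc k) u" "D (int b) k (u - int k + 1) = S b k u"
      if "b \<le> R" for b u
      using that 3 less.prems less.IH[of "Suc k" b u] less.IH[of k b u] by auto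
    have step: "S a k v * D (int a) m (v - int m + 1)
      = S a (Suc k) (v - 1) * S a (Suc k) (v + 1)
        - D (int a + 1) (Suc k) (v - int k) * D (int a - 1) (Suc k) (v - int k)"
      using D_Hirota[of "int a" k "v - int m + 1"] less.prems 3 IH(1)[of a "v - 1"]
        IH(1)[of a "v + 1"] IH(2)[of a v]
      by (simp add: algebra_simps)
    have "k \<le> L" "Suc k < L" using 3 less.prems by auto
    consider "a = 0" | "1 \<le> a" "a < R" | "a = R" "odd m" | "a = R" "even m"
      using less.prems by linarith
    then show ?thesis
    proof cases
      case 1
      then show ?thesis by (simp add: D_bottom S_bottom)
    next
      case 2
      have "D (int a + 1) (Suc k) (v - int k) = S (a + 1) (Suc k) v"
        using IH(1)[of "a + 1" v] 2 by (simp add: ac_simps)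
      moreover have "D (int a - 1) (Suc k) (v - int k) = S (a - 1) (Suc k) v"
        using IH(1)[of "a - 1" v] 2 by (simp add: of_nat_diff)
      ultimately have "S a k v * D (int a) m (v - int m + 1) = S a k v * S a m v"
        using step Hirota[of a "Suc k" v] 2 3 \<open>Suc k < L\<close> by (simp add: algebra_simps)
      then show ?thesis
        using S_unit 2 \<open>k \<le> L\<close> unit_cancel by blast
    next
      case 3
      then show ?thesis by (simp add: D_middle_odd S_middle_odd)
    next
      \<comment> \<open>On the mirror row the minors of odd size \<open>Suc k\<close> vanish and the
        two neighbouring rows are opposite, which leaves a square.\<close>
      case 4
      have odd: "odd (Suc k)" and ev: "even k" using 3 4 by auto
      have "D (int a - 1) (Suc k) (v - int k) = S (a - 1) (Suc k) v"
        using IH(1)[of "a - 1" v] 4 R by (simp add: of_nat_diff)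
      moreover have "D (int a + 1) (Suc k) (v - int k) = - D (int a - 1) (Suc k) (v - int k)"
        using D_skew[of "int a - 1" "Suc k" "v - int k"] 4 odd by (simp add: algebra_simps)
      moreover have "S a (Suc k) u = 0" for u
        using S_middle_odd odd 4 by simp
      ultimately have "S a k v * D (int a) m (v - int m + 1) = S a k v * S a m v"
        using step S_middle_even[OF ev, of v] 3 4 less.prems by (simp add: power2_eq_square)
      then show ?thesis
        using S_middle_unit[OF ev \<open>k \<le> L\<close>] 4 unit_cancel by blast
    qed
  qed
qed

lemma D_nat: "m \<le> L \<Longrightarrow> a \<le> R \<Longrightarrow> D (int a) m w = S a m (w + int m - 1)"
  using D_eq_S[of m a "w + int m - 1"] by simp

lemma reflect_cases:
  assumes "j \<le> 2 * R"
  obtains a where "a \<le> R" "int j = int a \<or> int j = 2 * int R - int a" "1 \<le> j \<and> j < 2 * R \<longrightarrow> 1 \<le> a"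
proof (cases "j \<le> R")
  case True
  then show ?thesis using that[of j] by auto
next
  case False
  show ?thesis
    by (rule that[of "2 * R - j"]) (use False assms in auto)
qed

lemma D_L:
  assumes "j \<le> 2 * R"
  shows "D (int j) L w = 1"
proof -
  obtain a where "a \<le> R" "int j = int a \<or> int j = 2 * int R - int a"
    using assms by (rule reflect_cases)
  then show ?thesis
    using D_skew[of "int a" L w] D_nat[of L a w] L by (auto simp: S_right)
qed

text \<open>All minors of size \<open>L\<close> are 1, so the Hirota equation reads 1 - 1 = 0 and a
  unit of size \<open>L - 1\<close> cancels. Row \<open>R\<close> is covered by the odd size
  \<open>Suc L\<close>.\<close>

lemma D_Suc_L:
  assumes "1 \<le> j" "j < 2 * R"
  shows "D (int j) (Suc L) w = 0"
proof -
  obtain a where a: "a \<le> R" "int j = int a \<or> int j = 2 * int R - int a" "1 \<le> a"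
    using assms reflect_cases[of j] by (metis less_or_eq_imp_le)
  have "D (int a) (Suc L) w = 0"
  proof (cases "a = R")
    case True
    then show ?thesis using L by (simp add: D_middle_odd)
  next
    case False
    obtain k where k: "L = Suc k" using L by (cases L) auto
    have *: "D (int a) L u = 1" "D (int a + 1) L u = 1" "D (int a - 1) L u = 1" for u
      using D_L[of a] D_L[of "a + 1"] D_L[of "a - 1"] a False
      by (simp_all add: of_nat_diff ac_simps)
    have "D (int a) (Suc L) w * D (int a) k (w + 2) = 0"
      using D_Hirota[of "int a" k w] * k by simp
    then have "S a k (w + 2 + int k - 1) * D (int a) (Suc L) w = S a k (w + 2 + int k - 1) * 0"
      using D_nat[of k a "w + 2"] k a by (simp add: mult.commute)
    then show ?thesis
      using S_unit[of a k] a False k unit_cancel[of "S a k (w + 2 + int k - 1)"] by simp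
  qed
  then show ?thesis
    using a(2) D_skew[of "int a" "Suc L" w] by auto
qed

section \<open>The linear relation between \<open>L + 1\<close> consecutive rows\<close>

text \<open>The matrix of the minors \<open>D\<close>, with its diagonals indexed by \<open>q - p\<close>; \<open>c w\<close> is the linear
  relation between its rows \<open>0, \<dots>, L\<close>, normalised by \<open>c w 0 = 1\<close>.\<close>

definition P :: "int \<Rightarrow> nat \<Rightarrow> nat \<Rightarrow> 'a" where
  "P w p q = e (int q - int p) (w + int p + int q)"

lemma fdet_P: "fdet m (\<lambda>p q. P w (i + p) (i + a + q)) = D (int a) m (w + int (2 * i + a))"
  unfolding D_def P_def by (intro fdet_cong) (simp add: algebra_simps)

lemma P_lower: "q < p \<Longrightarrow> P w p q = 0"
  by (simp add: P_def e_neg)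

lemma P_diag: "P w p p = 1"
  by (simp add: P_def e_0)

lemma P_top: "P w p (p + 2 * R) = - 1"
  by (simp add: P_def e_top)

lemma P_upper: "p + 2 * R < q \<Longrightarrow> P w p q = 0"
  by (simp add: P_def e_gt)

definition c :: "int \<Rightarrow> nat \<Rightarrow> 'a" where
  "c w p = fcof L (\<lambda>p q. P w p (q + 1)) p L"

lemma c_0: "c w 0 = 1"
proof -
  have "fdet L (\<lambda>p q. P w (Suc p) (Suc q)) = 1"
    using fdet_P[of L w 1 0] by (simp add: D_bottom)
  then show ?thesis
    using L by (simp add: c_def fcof_first_last)
qed

text \<open>Columns up to \<open>L\<close> are expansions along alien cofactors. Beyond, the square
  block ending in column \<open>q\<close> is singular and its other columns are killed by induction;
  as \<open>c w 0\<close> and the relevant cofactor are 1, Cramer's rule kills column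
  \<open>q\<close> too.\<close>

lemma sum_c_P:
  assumes "1 \<le> q" "q < 2 * R + L"
  shows "(\<Sum>p<Suc L. c w p * P w p q) = 0"
  using assms
proof (induction q rule: less_induct)
  case (less q)
  show ?case
  proof (cases "q \<le> L")
    case True
    then have "(\<Sum>k<Suc L. c w k * P w k ((q - 1) + 1)) = 0"
      unfolding c_def using less.prems by (subst sum_fcof_col) auto
    then show ?thesis using less.prems by simp
  next
    case False
    define j where "j = q - L"
    have j: "q = j + L" "1 \<le> j" "j < 2 * R" using False less.prems by (auto simp: j_def)
    let ?f = "\<lambda>p s. P w p (j + s)"
    have "c w 0 * fdet (Suc L) ?f = (\<Sum>p<Suc L. c w p * ?f p L) * fcof L ?f 0 L"
      by (rule sum_rows_cofactor) (use less.IH j in auto)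
    moreover have "fdet (Suc L) ?f = 0"
      using fdet_P[of "Suc L" w 0 j] D_Suc_L[of j] j by simp
    moreover have "fcof L ?f 0 L = 1"
    proof -
      have "fdet L (\<lambda>p s. P w (Suc p) (j + s)) = 1"
        using fdet_P[of L w 1 "j - 1"] D_L[of "j - 1"] j by simp
      then show ?thesis using L by (simp add: fcof_first_last)
    qed
    ultimately show ?thesis using j by (simp del: sum.lessThan_Suc)
  qed
qed

text \<open>Solving from the left: in columns 1 to \<open>k\<close> only rows up to \<open>k\<close>
  are nonzero, and row \<open>k\<close> contributes just its diagonal 1.\<close>

lemma c_eq_D_first:
  assumes "k \<le> L"
  shows "c w k = (- 1) ^ k * D 1 k (w + 1)"
proof (cases k)
  case 0
  then show ?thesis by (simp add: c_0 D_0)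
next
  case (Suc m)
  let ?f = "\<lambda>p q. P w p (Suc q)"
  have *: "(\<Sum>p<Suc m. c w p * P w p q) + (if q = Suc m then c w (Suc m) else 0) = 0"
    if "1 \<le> q" "q \<le> Suc m" for q
  proof -
    have "0 = (\<Sum>p<Suc L. c w p * P w p q)"
      using that assms Suc R by (subst sum_c_P) auto
    also have "\<dots> = (\<Sum>p<Suc (Suc m). c w p * P w p q)"
      by (rule sum.mono_neutral_right) (use that assms Suc in \<open>auto simp: P_lower\<close>)
    finally show ?thesis using that P_lower[of q "Suc m" w] by (auto simp: P_diag)
  qed
  have "c w 0 * fdet (Suc m) ?f = (\<Sum>p<Suc m. c w p * ?f p m) * fcof m ?f 0 m"
  proof (rule sum_rows_cofactor)
    show "(\<Sum>p<Suc m. c w p * ?f p q) = 0" if "q < Suc m" "q \<noteq> m" for q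
      using *[of "Suc q"] that by (simp del: sum.lessThan_Suc)
  qed simp_all
  moreover have "fdet (Suc m) ?f = D 1 k (w + 1)"
    using fdet_P[of "Suc m" w 0 1] Suc by simp
  moreover have "fcof m ?f 0 m = (- 1) ^ m"
    using fdet_P[of m w 1 0] by (simp add: fcof_first_last D_bottom)
  moreover have "(\<Sum>p<Suc m. c w p * ?f p m) = - c w k"
    using *[of "Suc m"] Suc by (simp add: eq_neg_iff_add_eq_0 del: sum.lessThan_Suc)
  ultimately have "D 1 k (w + 1) = (- 1) ^ k * c w k"
    using Suc by (simp add: c_0 mult.commute)
  then show ?thesis by (simp flip: mult.assoc power_mult_distrib)
qed

text \<open>Solving from the right: columns from \<open>2 * R + k\<close> on lie beyond the band of
  the rows before \<open>k\<close>, and row \<open>k\<close> contributes only its last entry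
  -1.\<close>

lemma c_eq_D_last:
  assumes "k \<le> L"
  shows "c w k = c w L * D (2 * int R - 1) (L - k) (w + 2 * int R + 2 * int k + 1)"
proof (cases "k = L")
  case True
  then show ?thesis by (simp add: D_0)
next
  case False
  define m where "m = L - Suc k"
  have m: "L = Suc k + m" "L - k = Suc m" using False assms by (auto simp: m_def)
  let ?f = "\<lambda>p q. P w (Suc k + p) (2 * R + k + q)"
  have *: "(\<Sum>p<Suc m. c w (Suc k + p) * ?f p q) = (if q = 0 then c w k else 0)" if "q < Suc m" for q
  proof -
    have "(\<Sum>p<k + Suc (Suc m). c w p * P w p (2 * R + k + q)) = 0"
      using sum_c_P[of "2 * R + k + q" w] that m R by simp
    then have "(\<Sum>p<k. c w p * P w p (2 * R + k + q)) + (\<Sum>p<Suc (Suc m). c w (k + p) * P w (k + p) (2 * R + k + q)) = 0"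
      unfolding sum_lessThan_add .
    moreover have "(\<Sum>p<k. c w p * P w p (2 * R + k + q)) = 0"
      by (intro sum.neutral) (auto simp: P_upper)
    ultimately have "c w k * P w k (2 * R + k + q) + (\<Sum>p<Suc m. c w (Suc k + p) * ?f p q) = 0"
      unfolding sum.lessThan_Suc_shift[of _ "Suc m"] by simp
    moreover have "P w k (2 * R + k + q) = (if q = 0 then - 1 else 0)"
      using P_top[of w k] P_upper[of k "2 * R + k + q" w] by (cases "q = 0") (simp_all add: add.commute)
    ultimately show ?thesis by (cases "q = 0") (simp_all del: sum.lessThan_Suc)
  qed
  have "c w (Suc k + m) * fdet (Suc m) ?f = (\<Sum>p<Suc m. c w (Suc k + p) * ?f p 0) * fcof m ?f m 0"
  proof (rule sum_rows_cofactor[where c = "\<lambda>p. c w (Suc k + p)"])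
    show "(\<Sum>p<Suc m. c w (Suc k + p) * ?f p q) = 0" if "q < Suc m" "q \<noteq> 0" for q
      using *[of q] that by (simp del: sum.lessThan_Suc)
  qed simp_all
  moreover have "fdet (Suc m) ?f = D (2 * int R - 1) (L - k) (w + 2 * int R + 2 * int k + 1)"
    using fdet_P[of "Suc m" w "Suc k" "2 * R - 1"] m R by (simp add: of_nat_diff algebra_simps)
  moreover have "fcof m ?f m 0 = 1"
  proof -
    have "fdet m (\<lambda>p q. ?f p (Suc q)) = (- 1) ^ m"
      using fdet_P[of m w "Suc k" "2 * R"] D_top[of m "w + int (2 * Suc k + 2 * R)"]
      by (simp add: algebra_simps)
    then show ?thesis by (simp add: fcof_last_first flip: power_mult_distrib)
  qed
  ultimately show ?thesis using *[of 0] m by (simp del: sum.lessThan_Suc)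
qed

section \<open>Half periodicity\<close>

lemma S_1_half_period:
  assumes "k \<le> L"
  shows "S 1 (L - k) (v + 2 * int R + int L) = S 1 k v"
proof -
  \<comment> \<open>Chosen so that \<open>D 1 k (?w + 1)\<close> is centred at
    \<open>v\<close>.\<close>
  let ?w = "v - int k"
  have D1: "D 1 m u = S 1 m (u + int m - 1)" if "m \<le> L" for m u
    using D_nat[of m 1 u] that R by simp
  have DN: "D (2 * int R - 1) m u = (- 1) ^ m * S 1 m (u + int m - 1)" if "m \<le> L" for m u
    using D_skew[of 1 m u] D1[OF that] by simp
  \<comment> \<open>The case \<open>k = 0\<close> compares the normalisations at the two
    ends.\<close>
  have "c ?w 0 = c ?w L * D (2 * int R - 1) L (?w + 2 * int R + 1)"
    using c_eq_D_last[of 0 ?w] by simp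
  then have "c ?w L = 1"
    using L R by (simp add: DN S_right c_0)
  have "?w + 2 * int R + 2 * int k + 1 + int (L - k) - 1 = v + 2 * int R + int L"
    using assms by simp
  then have "c ?w k = (- 1) ^ (L - k) * S 1 (L - k) (v + 2 * int R + int L)"
    using c_eq_D_last[OF assms, of ?w] DN[of "L - k" "?w + 2 * int R + 2 * int k + 1"]
    unfolding \<open>c ?w L = 1\<close> by (simp add: add_ac)
  moreover have "c ?w k = (- 1) ^ k * S 1 k v"
    using c_eq_D_first[OF assms, of ?w] D1[OF assms, of "?w + 1"] by simp
  \<comment> \<open>Evenness of \<open>L\<close> makes the signs of the two solutions agree.\<close>
  moreover have "(- 1) ^ (L - k) = (- 1 :: 'a) ^ k"
    using assms L by (simp add: minus_one_power_iff)
  ultimately show ?thesis by (cases "even k") auto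
qed

text \<open>The Hirota equation of row \<open>a - 1\<close> is compatible with the reflection of
  \<open>m\<close>, and determines row \<open>a\<close> because row \<open>a - 2\<close> consists of
  units.\<close>

lemma S_half_period:
  assumes "a < R" "m \<le> L"
  shows "S a m (v + 2 * int R + int L) = S a (L - m) v"
proof -
  define n where "n = 2 * int R + int L"
  have "S a m (v + n) = S a (L - m) v"
    using assms
  proof (induction a arbitrary: m v rule: less_induct)
    case (less a)
    consider "a = 0" | "a = 1" | b where "a = Suc (Suc b)"
      by (metis One_nat_def not0_implies_Suc)
    then show ?case
    proof cases
      case 1
      then show ?thesis by (simp add: S_bottom)
    next
      case 2
      then show ?thesis using S_1_half_period[of "L - m" v] less.prems by (simp add: n_def add_ac)
    next
      case (3 b)
      show ?thesis
      proof (cases "m = 0 \<or> m = L")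
        case True
        then show ?thesis using less.prems by (auto simp: S_left S_right)
      next
        case False
        then have m: "1 \<le> m" "m < L" "m - 1 \<le> L" "m + 1 \<le> L"
          "L - (m - 1) = L - m + 1" "L - (m + 1) = L - m - 1"
          using less.prems by auto
        have IH: "S d k (u + n) = S d (L - k) u" if "d \<le> Suc b" "k \<le> L" for d k u
          using less.IH[of d k u] less.prems that 3 by simp
        have shift: "v + n - 1 = v - 1 + n" "v + n + 1 = v + 1 + n" by simp_all
        have "S (Suc b) m (v + n - 1) * S (Suc b) m (v + n + 1)
            = S (Suc b) (m - 1) (v + n) * S (Suc b) (m + 1) (v + n) + S b m (v + n) * S a m (v + n)"
          using Hirota[of "Suc b" m "v + n"] m less.prems 3 by simp
        then have "S (Suc b) (L - m) (v - 1) * S (Suc b) (L - m) (v + 1)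
            = S (Suc b) (L - m + 1) v * S (Suc b) (L - m - 1) v + S b (L - m) v * S a m (v + n)"
          using m less.prems by (simp only: shift IH le_refl le_SucI)
        moreover have "S (Suc b) (L - m) (v - 1) * S (Suc b) (L - m) (v + 1)
            = S (Suc b) (L - m - 1) v * S (Suc b) (L - m + 1) v + S b (L - m) v * S a (L - m) v"
          using Hirota[of "Suc b" "L - m" v] m less.prems 3 by simp
        ultimately have "S b (L - m) v * S a m (v + n) = S b (L - m) v * S a (L - m) v"
          by (simp add: mult.commute)
        moreover have "S b (L - m) v dvd 1"
          using S_unit[of b "L - m" v] less.prems 3 by (cases "b = 0") (auto simp: S_bottom)
        ultimately show ?thesis using unit_cancel by blast
      qed
    qed
  qed
  then show ?thesis by (simp add: n_def add_ac)
qed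

end

section \<open>Unfolding type C\<close>

text \<open>The products in row \<open>r\<close> are those in the relations of row
  \<open>r - 1\<close>, which thus become Hirota equations.\<close>

definition unfold :: "nat \<Rightarrow> (nat \<Rightarrow> nat \<Rightarrow> int \<Rightarrow> 'a) \<Rightarrow> nat \<Rightarrow> nat \<Rightarrow> int \<Rightarrow> 'a::comm_ring_1" where
  "unfold r T a m v =
    (if a < r then T a m v
     else if a = r then
       (if even m then T r (m div 2) (v - 1) * T r (m div 2) (v + 1)
        else T r (m div 2) v * T r (m div 2 + 1) v)
     else if even m then (T r (m div 2) v)\<^sup>2 else 0)"

lemma skew_frieze_unfold:
  fixes r l :: nat and T :: "nat \<Rightarrow> nat \<Rightarrow> int \<Rightarrow> 'a::comm_ring_1"
  assumes r: "r \<ge> 2" and l: "l \<ge> 2" and T: "is_TsysC r l T"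
  shows "skew_frieze (r + 1) (2 * l) (unfold r T)"
proof -
  note T' = T[unfolded is_TsysC_def]
  have bottom: "T 0 m v = 1" for m v using T' by blast
  have left: "T a 0 v = 1" if "1 \<le> a" "a \<le> r" for a v using T' that by blast
  have right: "T a (2 * l) v = 1" if "1 \<le> a" "a \<le> r - 1" for a v using T' that by blast
  have rel: "T a m (v - 1) * T a m (v + 1)
      = T a (m - 1) v * T a (m + 1) v + T (a - 1) m v * T (a + 1) m v"
    if "1 \<le> a" "a \<le> r - 2" "1 \<le> m" "m \<le> 2 * l - 1" for a m v
    using T' that by blast
  have rel_even: "T (r - 1) (2 * m) (v - 1) * T (r - 1) (2 * m) (v + 1)
      = T (r - 1) (2 * m - 1) v * T (r - 1) (2 * m + 1) v + T (r - 2) (2 * m) v * T r m (v - 1) * T r m (v + 1)"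
    if "1 \<le> m" "m \<le> l - 1" for m v
    using T' that by blast
  have rel_odd: "T (r - 1) (2 * m + 1) (v - 1) * T (r - 1) (2 * m + 1) (v + 1)
      = T (r - 1) (2 * m) v * T (r - 1) (2 * m + 2) v + T (r - 2) (2 * m + 1) v * T r m v * T r (m + 1) v"
    if "m \<le> l - 1" for m v
    using T' that by blast
  have rel_r: "T r m (v - 2) * T r m (v + 2) = T r (m - 1) v * T r (m + 1) v + T (r - 1) (2 * m) v"
    if "1 \<le> m" "m \<le> l - 1" for m v
    using T' that by blast
  have sq: "(T r l v)\<^sup>2 = 1" and per: "T r l (v + 2) = T r l v" for v
    using T' by blast+
  have unit: "T a m v dvd 1" if "1 \<le> a" "a < r" "m \<le> 2 * l" for a m v
  proof -
    consider "m = 0" | "m = 2 * l" | "1 \<le> m" "m \<le> 2 * l - 1" using \<open>m \<le> 2 * l\<close> by linarith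
    then show ?thesis using that left[of a v] right[of a v] T' by cases auto
  qed
  have unit_r: "T r m v dvd 1" if "m \<le> l" for m v
  proof -
    consider "m = 0" | "m = l" | "1 \<le> m" "m \<le> l - 1" using \<open>m \<le> l\<close> by linarith
    then show ?thesis
    proof cases
      case 2
      then show ?thesis using sq[of v] by (metis dvd_triv_left power2_eq_square)
    qed (use r left[of r v] T' in auto)
  qed
  have mult_unit: "x * y dvd 1" if "x dvd 1" "y dvd 1" for x y :: 'a
    using mult_dvd_mono[OF that] by simp
  show ?thesis
  proof
    show "2 \<le> r + 1" "2 \<le> 2 * l" "even (2 * l)" using r l by auto
  next
    fix a m v assume "1 \<le> a" "a < r + 1" "m \<le> 2 * l"
    then show "unfold r T a m v dvd 1"
      by (auto simp: unfold_def intro!: unit mult_unit unit_r elim!: oddE)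
  next
    fix m v show "unfold r T 0 m v = 1" using r by (simp add: unfold_def bottom)
  next
    fix a v assume "a \<le> r + 1"
    then show "unfold r T a 0 v = 1"
      using r left[of a v] left[of r] bottom[of 0 v] by (cases "a = 0") (auto simp: unfold_def)
    \<comment> \<open>The quasi-unit condition enters here: the boundary value need not be 1, but
      its products in row \<open>r\<close> are.\<close>
    have "T r l (v - 1) * T r l (v + 1) = 1"
      using per[of "v - 1"] sq[of "v - 1"] by (simp add: power2_eq_square add.commute)
    then show "unfold r T a (2 * l) v = 1"
      using r right[of a v] bottom[of "2 * l" v] sq[of v] by (cases "a = 0") (auto simp: unfold_def)
  next
    fix a m v assume *: "1 \<le> a" "a < r + 1" "1 \<le> m" "m < 2 * l"
    consider "a \<le> r - 2" | "a = r - 1" | "a = r" using * by linarith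
    then show "unfold r T a m (v - 1) * unfold r T a m (v + 1)
      = unfold r T a (m - 1) v * unfold r T a (m + 1) v + unfold r T (a - 1) m v * unfold r T (a + 1) m v"
    proof cases
      case 1
      then have "a < r" "a - 1 < r" "a + 1 < r" using * r by linarith+
      then show ?thesis using rel[of a m v] 1 * by (simp add: unfold_def)
    next
      case 2
      then have a: "a < r" "a - 1 = r - 2" "a - 1 < r" "a + 1 = r" using r by auto
      show ?thesis
      proof (cases "even m")
        case True
        then obtain k where "m = 2 * k" by blast
        then show ?thesis using rel_even[of k v] * a 2 by (simp add: unfold_def mult.assoc)
      next
        case False
        then obtain k where "m = 2 * k + 1" by (rule oddE)
        then show ?thesis using rel_odd[of k v] * a 2 by (simp add: unfold_def mult.assoc)
      qed
    next
      case 3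
      then have a: "a - 1 < r" using r by auto
      show ?thesis
      proof (cases "even m")
        case True
        then obtain k where k: "m = 2 * k" by blast
        then have "k = Suc (k - 1)" "(m - 1) div 2 = k - 1" "odd (m - 1)" using * by auto
        \<comment> \<open>The relation of row \<open>r\<close>, multiplied by the entry
          \<open>(T r k v)\<^sup>2\<close> of the added row.\<close>
        have "T r k (v - 2) * T r k (v + 2) * (T r k v)\<^sup>2
            = (T r (k - 1) v * T r (k + 1) v + T (r - 1) (2 * k) v) * (T r k v)\<^sup>2"
          using rel_r[of k v] k * by simp
        then show ?thesis using k 3 a * \<open>(m - 1) div 2 = k - 1\<close> \<open>odd (m - 1)\<close>
          by (simp add: unfold_def algebra_simps power2_eq_square)
      next
        case False
        then obtain k where "m = 2 * k + 1" by (rule oddE)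
        \<comment> \<open>For odd \<open>m\<close> the added row is 0, and both sides are the same
          four factors.\<close>
        then show ?thesis using 3 a by (simp add: unfold_def ac_simps)
      qed
    qed
  next
    fix m v assume "even (m::nat)" "m \<le> 2 * l"
    then show "unfold r T (r + 1) m v dvd 1"
      by (auto simp: unfold_def power2_eq_square intro!: mult_unit unit_r)
  next
    fix m v assume "odd (m::nat)"
    then show "unfold r T (r + 1) m v = 0" by (simp add: unfold_def)
  next
    fix m v assume "even (m::nat)"
    then show "unfold r T (r + 1) m v * unfold r T (r + 1) (m + 2) v = (unfold r T (r + 1 - 1) (m + 1) v)\<^sup>2"
      by (simp add: unfold_def power_mult_distrib)
  qed
qed

theorem theorem6p3:
  fixes r l :: nat and T :: "nat \<Rightarrow> nat \<Rightarrow> int \<Rightarrow> 'a::comm_ring_1"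
  assumes "r \<ge> 2" and "l \<ge> 2" and "is_TsysC r l T"
  shows "(\<forall>a m v. 1 \<le> a \<and> a \<le> r - 1 \<and> 1 \<le> m \<and> m \<le> 2*l - 1 \<longrightarrow>
            T a m (v + 2 * int (r + 1 + l)) = T a (2*l - m) v)
       \<and> (\<forall>m v. 1 \<le> m \<and> m \<le> l - 1 \<longrightarrow>
            T r m (v + 2 * int (r + 1 + l)) = T r l v * T r (l - m) v)
       \<and> (\<forall>a m v. 1 \<le> a \<and> a \<le> r - 1 \<and> 1 \<le> m \<and> m \<le> 2*l - 1 \<longrightarrow>
            T a m (v + 4 * int (r + 1 + l)) = T a m v)
       \<and> (\<forall>m v. 1 \<le> m \<and> m \<le> l \<longrightarrow>
            T r m (v + 4 * int (r + 1 + l)) = T r m v)"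
proof -
  interpret skew_frieze "r + 1" "2 * l" "unfold r T"
    by (rule skew_frieze_unfold[OF assms])
  \<comment> \<open>This is \<open>2 * R + L\<close> for \<open>R = r + 1\<close> and
    \<open>L = 2 * l\<close>.\<close>
  define n where "n = 2 * int (r + 1 + l)"
  have half: "unfold r T a m (v + n) = unfold r T a (2 * l - m) v" if "a \<le> r" "m \<le> 2 * l" for a m v
    using S_half_period[of a m v] that by (simp add: n_def algebra_simps)
  have sq: "T r l v * T r l v = 1" and per: "T r l (v + 2) = T r l v" for v
    using assms(3) by (auto simp: is_TsysC_def power2_eq_square)
  have T0: "T r 0 v = 1" for v
    using assms by (auto simp: is_TsysC_def)
  have unit: "T r m v dvd 1" if "m < l" for m v
    using that assms(3) T0[of v] by (cases "m = 0") (auto simp: is_TsysC_def)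
  have A: "T a m (v + n) = T a (2 * l - m) v" if "a \<le> r - 1" "m \<le> 2 * l" for a m v
  proof -
    have "a < r" using that assms(1) by linarith
    then show ?thesis using half[of a m v] that by (simp add: unfold_def)
  qed
  \<comment> \<open>The odd entries of row \<open>r\<close> are products of neighbours, so induction
    from \<open>T r 0\<close> divides out one factor at a time. The factor \<open>T r l v\<close>
    comes from the start \<open>m = 0\<close>, as its own inverse.\<close>
  have B: "T r m (v + n) = T r l v * T r (l - m) v" if "m \<le> l" for m v
    using that
  proof (induction m)
    case 0
    then show ?case by (simp add: T0 sq)
  next
    case (Suc m)
    have d: "2 * l - (2 * m + 1) = 2 * (l - Suc m) + 1" "l - Suc m + 1 = l - m" using Suc.prems by auto
    have "T r m (v + n) * T r (Suc m) (v + n) = T r (l - Suc m) v * T r (l - m) v"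
      using half[of r "2 * m + 1" v] Suc.prems d by (simp add: unfold_def)
    also have "\<dots> = (T r l v * T r l v) * (T r (l - Suc m) v * T r (l - m) v)"
      by (simp add: sq)
    also have "\<dots> = T r m (v + n) * (T r l v * T r (l - Suc m) v)"
      using Suc by (simp add: ac_simps)
    finally show ?case
      using unit[of m "v + n"] Suc.prems unit_cancel[of "T r m (v + n)"] by simp
  qed
  have per2: "T r l (v + 2 * int k) = T r l v" for k v
    using per[of "v + 2 * int k" for k] by (induction k) (simp_all add: algebra_simps)
  \<comment> \<open>\<open>n\<close> is even, so the period 2 suffices.\<close>
  have per_n: "T r l (v + n) = T r l v" for v
    using per2[of v "r + 1 + l"] by (simp add: n_def)
  have nn: "v + 4 * int (r + 1 + l) = v + n + n" for v
    by (simp add: n_def)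
  have A2: "T a m (v + n + n) = T a m v" if "a \<le> r - 1" "m \<le> 2 * l" for a m v
    using A[of a m "v + n"] A[of a "2 * l - m" v] that by simp
  have B2: "T r m (v + n + n) = T r m v" if "m \<le> l" for m v
  proof -
    have "T r m (v + n + n) = (T r l v * T r l v) * T r m v"
      using B[of m "v + n"] B[of "l - m" v] that by (simp add: per_n mult.assoc)
    then show ?thesis by (simp add: sq)
  qed
  show ?thesis
    unfolding nn unfolding n_def[symmetric] using A A2 B B2 by auto
qed

end
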